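(* If $H=(V,E)$ is a $3$-uniform hypergraph and the graph $H_2$ is factor-critical, then $V$ has a partition into one triangle $\{a,b,c\}\in E$ and a perfect matching in $H_2-\{a,b,c\}$.
   Context: A hypergraph $H=(V,E)$ consists of a vertex set $V$ and a family $E$ of subsets of $V$ called hyperedges, where hyperedges may be present with multiplicities. $H$ is $3$-uniform if all of its hyperedges have $3$ elements. A triangle is a hyperedge of cardinality $3$. The graph $H_2=(V,E_2)$ is the simple graph (no loops, no parallel edges) on $V$ whose edges are all $2$-element subsets of hyperedges of $H$. For a graph $G$ and a set $S$ of its vertices, $G-S$ denotes the graph obtained by deleting the vertices in $S$. A matching in a graph is a set of pairwise vertex-disjoint edges; it is perfect if it partitions the vertex set of the graph. A graph $G$ is factor-critical if $G-v$ has a perfect matching for every vertex $v$ of $G$.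
   Formalization: H is taken to be finite, as usual, and to have at least one hyperedge; without a hyperedge the claim fails, e.g. for a single vertex, where H_2 is factor-critical but there is no triangle. *)

theory Defs
  imports "HOL-Library.Multiset" "HOL-Library.Disjoint_Sets"
begin

text \<open>A hypergraph is a finite vertex set with a multiset of hyperedges, so that hyperedges
  may be repeated.\<close>

definition hypergraph :: "'a set \<Rightarrow> 'a set multiset \<Rightarrow> bool" where
  "hypergraph V E \<longleftrightarrow> finite V \<and> (\<forall>e \<in># E. e \<subseteq> V)"

definition uniform :: "nat \<Rightarrow> 'a set multiset \<Rightarrow> bool" where
  "uniform k E \<longleftrightarrow> (\<forall>e \<in># E. card e = k)"

definition triangle :: "'a set multiset \<Rightarrow> 'a set \<Rightarrow> bool" where
  "triangle E T \<longleftrightarrow> T \<in># E \<and> card T = 3"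

text \<open>A simple graph is a pair of a vertex set and a set of two-element subsets of it.\<close>

type_synonym 'a graph = "'a set \<times> 'a set set"

abbreviation verts :: "'a graph \<Rightarrow> 'a set" where
  "verts G \<equiv> fst G"

abbreviation edges :: "'a graph \<Rightarrow> 'a set set" where
  "edges G \<equiv> snd G"

text \<open>The graph $H_2$ of a hypergraph $H = (V, E)$.\<close>

definition two_section :: "'a set \<Rightarrow> 'a set multiset \<Rightarrow> 'a graph" where
  "two_section V E = (V, {f. card f = 2 \<and> (\<exists>e \<in># E. f \<subseteq> e)})"

definition delete_verts :: "'a graph \<Rightarrow> 'a set \<Rightarrow> 'a graph" where
  "delete_verts G S = (verts G - S, {f \<in> edges G. f \<inter> S = {}})"

definition matching :: "'a graph \<Rightarrow> 'a set set \<Rightarrow> bool" where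
  "matching G M \<longleftrightarrow> M \<subseteq> edges G \<and> disjoint M"

definition perfect_matching :: "'a graph \<Rightarrow> 'a set set \<Rightarrow> bool" where
  "perfect_matching G M \<longleftrightarrow> matching G M \<and> partition_on (verts G) M"

text \<open>By this definition the empty graph and the graph with a single vertex are
  factor-critical.\<close>

definition factor_critical :: "'a graph \<Rightarrow> bool" where
  "factor_critical G \<longleftrightarrow> (\<forall>v \<in> verts G. \<exists>M. perfect_matching (delete_verts G {v}) M)"

end

theory Submission
  imports Defs
begin

text \<open>A factor-critical graph with more than one vertex arises from a smaller factor-critical
  subgraph on \<open>U\<close> by adding an odd ear with inner vertices \<open>q\<^sub>1, \<dots>, q\<^sub>2\<^sub>m\<close> (Lovasz). Let
  \<open>w\<close> be the third vertex of a hyperedge containing \<open>q\<^sub>1\<close> and \<open>q\<^sub>2\<close>. If \<open>w \<in> U\<close>, or if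
  \<open>w = q\<^sub>j\<close> with \<open>j\<close> odd, then deleting \<open>q\<^sub>1, q\<^sub>2, w\<close> leaves a perfectly matchable graph,
  because \<open>U\<close> minus any one vertex is matchable. If \<open>j\<close> is even, the ear
  \<open>q\<^sub>1, q\<^sub>j, q\<^sub>j\<^sub>+\<^sub>1, \<dots>\<close> can be added to \<open>U\<close> first, and \<open>q\<^sub>2, \<dots>, q\<^sub>j\<^sub>-\<^sub>1\<close> is a shorter last
  ear.\<close>

section \<open>Matchable vertex sets\<close>

text \<open>The edge set \<open>F\<close> stays fixed and a subgraph is given by its vertices alone:
  the blocks of a partition of \<open>S\<close> lie in \<open>S\<close>, so \<open>M\<close> only
  uses edges induced on \<open>S\<close>.\<close>

definition matchable :: "'a set set \<Rightarrow> 'a set \<Rightarrow> bool" where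
  "matchable F S \<longleftrightarrow> (\<exists>M\<subseteq>F. partition_on S M)"

definition fcrit :: "'a set set \<Rightarrow> 'a set \<Rightarrow> bool" where
  "fcrit F U \<longleftrightarrow> (\<forall>u\<in>U. matchable F (U - {u}))"

abbreviation path_in :: "'a set set \<Rightarrow> 'a list \<Rightarrow> bool" where
  "path_in F \<equiv> successively (\<lambda>x y. {x, y} \<in> F)"

text \<open>The list consists of the inner vertices of the ear only; its two ends may coincide.\<close>

definition odd_ear :: "'a set set \<Rightarrow> 'a set \<Rightarrow> 'a list \<Rightarrow> bool" where
  "odd_ear F U qs \<longleftrightarrow> qs \<noteq> [] \<and> even (length qs) \<and> distinct qs \<and> set qs \<inter> U = {} \<and> path_in F qs
    \<and> (\<exists>u\<in>U. {u, hd qs} \<in> F) \<and> (\<exists>w\<in>U. {last qs, w} \<in> F)"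

lemma partition_on_union:
  assumes "partition_on S M" "partition_on T N" "S \<inter> T = {}"
  shows "partition_on (S \<union> T) (M \<union> N)"
  using assms by (auto simp: partition_on_def intro!: disjoint_union)

lemma matchable_Un:
  assumes "matchable F S" "matchable F T" "S \<inter> T = {}"
  shows "matchable F (S \<union> T)"
proof -
  obtain M N where "M \<subseteq> F" "partition_on S M" "N \<subseteq> F" "partition_on T N"
    using assms(1,2) unfolding matchable_def by blast
  then have "M \<union> N \<subseteq> F" "partition_on (S \<union> T) (M \<union> N)"
    using assms(3) by (simp_all add: partition_on_union)
  then show ?thesis
    unfolding matchable_def by blast
qed

text \<open>Consecutive vertices are paired off from the front.\<close>

lemma matchable_path:
  assumes "distinct qs" "even (length qs)" "path_in F qs"
  shows "matchable F (set qs)"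
  using assms
proof (induction qs rule: induct_list012)
  case 1
  then show ?case
    by (auto simp: matchable_def partition_on_empty)
next
  case (2 x)
  then show ?case by simp
next
  case (3 x y qs)
  have "path_in F qs"
    using "3.prems"(3) by (cases qs) auto
  then have "matchable F (set qs)"
    using 3 by simp
  moreover have "matchable F {x, y}"
    unfolding matchable_def using "3.prems"(3)
    by (intro exI[of _ "{{x, y}}"]) (auto simp: partition_on_def)
  ultimately have "matchable F ({x, y} \<union> set qs)"
    using "3.prems"(1) by (intro matchable_Un) auto
  then show ?case by simp
qed

lemma even_card_matchable:
  assumes "matchable F S" "finite S" "\<forall>f\<in>F. card f = 2"
  shows "even (card S)"
proof -
  obtain M where M: "M \<subseteq> F" "partition_on S M"
    using assms(1) unfolding matchable_def by blast
  have "card S = (\<Sum>e\<in>M. card e)"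
  proof (rule product_partition[OF M(2)])
    show "finite e" if "e \<in> M" for e
      using that M(2) assms(2) by (auto simp: partition_on_def intro: finite_subset)
  qed
  also have "even \<dots>"
    using M(1) assms(3) by (intro dvd_sum) auto
  finally show ?thesis .
qed

text \<open>A matching restricts to a vertex set whose boundary none of its edges crosses. This
  serves to find a crossing edge, and to match what an ear leaves over.\<close>

lemma partition_on_subset:
  assumes "partition_on S M" "T \<subseteq> S" "\<forall>e\<in>M. e \<inter> T = {} \<or> e \<subseteq> T"
  shows "partition_on T {e \<in> M. e \<subseteq> T}"
  unfolding partition_on_def
proof (intro conjI)
  show "\<Union>{e \<in> M. e \<subseteq> T} = T"
  proof
    show "T \<subseteq> \<Union>{e \<in> M. e \<subseteq> T}"
    proof
      fix x assume x: "x \<in> T"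
      then have "x \<in> \<Union>M"
        using assms(1,2) by (auto simp: partition_on_def)
      then obtain e where "e \<in> M" "x \<in> e"
        by (elim UnionE)
      then show "x \<in> \<Union>{e \<in> M. e \<subseteq> T}"
        using assms(3) x by auto
    qed
  qed auto
  show "disjoint {e \<in> M. e \<subseteq> T}"
    by (rule pairwise_subset[OF partition_onD2[OF assms(1)]]) simp
qed (use partition_onD3[OF assms(1)] in simp)

lemma partition_on_pair:
  assumes "partition_on S M" "M \<subseteq> F" "\<forall>f\<in>F. card f = 2" "x \<in> S"
  obtains y where "{x, y} \<in> M" "y \<noteq> x" "y \<in> S"
proof -
  obtain e where e: "e \<in> M" "x \<in> e"
    using assms(1,4) by (auto simp: partition_on_def)
  then have "card e = 2"
    using assms by auto
  then obtain y where "e = {x, y}" "y \<noteq> x"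
    using e(2) by (auto simp: card_2_iff doubleton_eq_iff)
  moreover have "y \<in> S"
    using e(1) \<open>e = {x, y}\<close> assms(1) by (auto simp: partition_on_def)
  ultimately show ?thesis
    using that e(1) by blast
qed

lemma partition_on_unique:
  assumes "partition_on S M" "e \<in> M" "f \<in> M" "x \<in> e" "x \<in> f"
  shows "e = f"
  using assms by (auto simp: partition_on_def disjoint_def)

section \<open>Attaching an odd ear\<close>

lemma odd_ear_rev:
  assumes "odd_ear F U qs"
  shows "odd_ear F U (rev qs)"
  using assms unfolding odd_ear_def
  by (auto simp: hd_rev last_rev insert_commute)

text \<open>By parity \<open>as\<close> has odd length, so the attachment vertex \<open>u\<close>
  followed by \<open>as\<close> is a path of even length. This path, \<open>bs\<close> and
  \<open>U - {u}\<close> are matched separately.\<close>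

lemma matchable_ear_minus:
  assumes "fcrit F U" "odd_ear F U (as @ x # bs)" "even (length bs)"
  shows "matchable F (U \<union> set (as @ x # bs) - {x})"
proof -
  note ear = assms(2)[unfolded odd_ear_def]
  obtain u where u: "u \<in> U" "{u, hd (as @ x # bs)} \<in> F"
    using ear by blast
  have "as \<noteq> []"
    using ear assms(3) by auto
  have "matchable F (set (u # as))"
  proof (rule matchable_path)
    show "distinct (u # as)" "even (length (u # as))"
      using ear u(1) assms(3) by auto
    show "path_in F (u # as)"
      using ear u \<open>as \<noteq> []\<close> by (auto simp: successively_append_iff successively_Cons)
  qed
  moreover have "matchable F (set bs)"
    using ear assms(3)
    by (intro matchable_path) (auto simp: successively_append_iff successively_Cons)
  ultimately have "matchable F (set (u # as) \<union> set bs)"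
    using ear u by (intro matchable_Un) auto
  moreover have "matchable F (U - {u})"
    using assms(1) u(1) unfolding fcrit_def by blast
  ultimately have "matchable F ((set (u # as) \<union> set bs) \<union> (U - {u}))"
    using ear by (elim matchable_Un) auto
  moreover have "(set (u # as) \<union> set bs) \<union> (U - {u}) = U \<union> set (as @ x # bs) - {x}"
    using ear u(1) by auto
  ultimately show ?thesis by simp
qed

text \<open>A vertex deleted from the ear splits it into an even and an odd piece. After reversal,
  if necessary, the odd piece comes first and is completed by a vertex of \<open>U\<close>. If the
  deleted vertex lies in \<open>U\<close>, the ear is matched within itself.\<close>

lemma fcrit_ear:
  assumes "fcrit F U" "odd_ear F U qs"
  shows "fcrit F (U \<union> set qs)"
  unfolding fcrit_def
proof
  fix x assume x: "x \<in> U \<union> set qs"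
  note ear = assms(2)[unfolded odd_ear_def]
  show "matchable F (U \<union> set qs - {x})"
  proof (cases "x \<in> U")
    case True
    then have "matchable F (U - {x})"
      using assms(1) unfolding fcrit_def by blast
    moreover have "matchable F (set qs)"
      using ear by (intro matchable_path) auto
    ultimately have "matchable F ((U - {x}) \<union> set qs)"
      using ear by (intro matchable_Un) auto
    moreover have "(U - {x}) \<union> set qs = U \<union> set qs - {x}"
      using ear True by auto
    ultimately show ?thesis by simp
  next
    case False
    then obtain as bs where qs: "qs = as @ x # bs"
      using x by (meson UnE split_list)
    show ?thesis
    proof (cases "even (length bs)")
      case True
      then show ?thesis
        using matchable_ear_minus[of F U as x bs] assms qs by simp
    next
      case False
      then have "even (length (rev as))"
        using ear qs by simp
      moreover have "odd_ear F U (rev bs @ x # rev as)"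
        using odd_ear_rev[OF assms(2)] qs by simp
      ultimately have "matchable F (U \<union> set (rev bs @ x # rev as) - {x})"
        using matchable_ear_minus[OF assms(1)] by blast
      then show ?thesis
        by (simp add: qs Un_commute)
    qed
  qed
qed

section \<open>Existence of a last ear\<close>

text \<open>The walk from \<open>z\<close> that uses \<open>M\<close> and \<open>N\<close> alternately. As \<open>N\<close> misses \<open>z\<close>, the walk cannot
  close up, so it has to leave the complement of \<open>U\<close>.\<close>

lemma alternating_walk:
  assumes "finite V" and F: "\<forall>f\<in>F. card f = 2"
    and M: "partition_on (V - U) M" "M \<subseteq> F"
    and N: "partition_on (V - {z}) N" "N \<subseteq> F"
    and z: "z \<in> V - U"
  obtains qs w where "qs \<noteq> []" "even (length qs)" "distinct qs" "path_in F qs"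
    "set qs \<subseteq> V - U" "hd qs = z" "\<forall>e\<in>M. e \<inter> set qs = {} \<or> e \<subseteq> set qs"
    "w \<in> U" "{last qs, w} \<in> F"
proof -
  \<comment> \<open>Alternation is recorded as closure: the walk contains the
    \<open>M\<close>-partner of each of its vertices, and its vertices other than \<open>z\<close>
    and the last one are closed under \<open>N\<close>-partners. \<open>N\<close> misses
    \<open>z\<close>, and the \<open>N\<close>-edge at the last vertex is the next one to
    follow.\<close>
  define inv where "inv qs \<longleftrightarrow> qs \<noteq> [] \<and> even (length qs) \<and> distinct qs \<and> path_in F qs
    \<and> set qs \<subseteq> V - U \<and> hd qs = z \<and> (\<forall>e\<in>M. e \<inter> set qs = {} \<or> e \<subseteq> set qs)
    \<and> (\<forall>e\<in>N. e \<inter> (set qs - {z, last qs}) = {} \<or> e \<subseteq> set qs - {z, last qs})" for qs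
  obtain z' where z': "{z, z'} \<in> M" "z' \<noteq> z" "z' \<in> V - U"
    using partition_on_pair[OF M F z] .
  have closed_M: "e \<inter> {a, b} = {} \<or> e \<subseteq> {a, b}" if "{a, b} \<in> M" "e \<in> M" for e a b
    using partition_on_unique[OF M(1) that] by auto
  have "inv [z, z']"
    unfolding inv_def using z z' M(2) closed_M[OF z'(1)] by auto
  moreover have "length qs < Suc (card V)" if "inv qs" for qs
    using that \<open>finite V\<close> unfolding inv_def
    by (metis Diff_subset card_mono distinct_card le_imp_less_Suc order_trans)
  ultimately obtain qs where qs: "inv qs" and max: "\<And>rs. inv rs \<Longrightarrow> length rs \<le> length qs"
    using ex_has_greatest_nat[of inv "[z, z']" length "Suc (card V)"] by blast
  have q: "qs \<noteq> []" "even (length qs)" "distinct qs" "path_in F qs" "set qs \<subseteq> V - U" "hd qs = z"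
    and q_M: "\<And>e. e \<in> M \<Longrightarrow> e \<inter> set qs = {} \<or> e \<subseteq> set qs"
    and q_N: "\<And>e. e \<in> N \<Longrightarrow> e \<inter> (set qs - {z, last qs}) = {} \<or> e \<subseteq> set qs - {z, last qs}"
    using qs unfolding inv_def by blast+
  define y where "y = last qs"
  have y: "y \<in> set qs" "y \<noteq> z"
  proof -
    show "y \<in> set qs"
      using q by (simp add: y_def)
    obtain r rs where "qs = z # r # rs"
      using q by (metis even_Suc length_Cons list.exhaust list.sel(1) list.size(3) even_zero)
    then show "y \<noteq> z"
      using q unfolding y_def by (metis distinct.simps(2) last_ConsR last_in_set list.distinct(1))
  qed
  have yV: "y \<in> V - {z}"
    using y q by auto
  \<comment> \<open>If the next vertex \<open>y'\<close> were outside \<open>U\<close>, it would be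
    new, and adding it with its \<open>M\<close>-partner would lengthen the longest walk.\<close>
  obtain y' where y': "{y, y'} \<in> N" "y' \<noteq> y" "y' \<in> V - {z}"
    using partition_on_pair[OF N F yV] .
  have "y' \<in> U"
  proof (rule ccontr)
    assume "y' \<notin> U"
    have new: "y' \<notin> set qs"
    proof
      assume "y' \<in> set qs"
      then have "y' \<in> {y, y'} \<inter> (set qs - {z, last qs})"
        using y' by (auto simp: y_def)
      then have "{y, y'} \<subseteq> set qs - {z, last qs}"
        using q_N[OF y'(1)] by blast
      then show False
        by (auto simp: y_def)
    qed
    have yU: "y' \<in> V - U"
      using y' \<open>y' \<notin> U\<close> by auto
    obtain y'' where y'': "{y', y''} \<in> M" "y'' \<noteq> y'" "y'' \<in> V - U"
      using partition_on_pair[OF M F yU] .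
    have "{y', y''} \<inter> set qs = {} \<or> {y', y''} \<subseteq> set qs"
      by (rule q_M[OF y''(1)])
    then have new': "y'' \<notin> set qs"
      using new by auto
    have "inv (qs @ [y', y''])"
      unfolding inv_def
    proof (intro conjI)
      show "path_in F (qs @ [y', y''])"
        using q y'(1) y''(1) M(2) N(2) by (auto simp: successively_append_iff y_def)
      show "\<forall>e\<in>M. e \<inter> set (qs @ [y', y'']) = {} \<or> e \<subseteq> set (qs @ [y', y''])"
      proof
        fix e assume e: "e \<in> M"
        have "e \<inter> set qs = {} \<or> e \<subseteq> set qs"
          using q_M e .
        moreover have "e \<inter> {y', y''} = {} \<or> e \<subseteq> {y', y''}"
          using closed_M y''(1) e .
        ultimately show "e \<inter> set (qs @ [y', y'']) = {} \<or> e \<subseteq> set (qs @ [y', y''])"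
          by auto
      qed
      have eq: "set (qs @ [y', y'']) - {z, last (qs @ [y', y''])}
          = (set qs - {z, last qs}) \<union> {y, y'}"
        using y y' y'' new new' by (auto simp: y_def)
      show "\<forall>e\<in>N. e \<inter> (set (qs @ [y', y'']) - {z, last (qs @ [y', y''])}) = {}
          \<or> e \<subseteq> set (qs @ [y', y'']) - {z, last (qs @ [y', y''])}"
      proof
        fix e assume e: "e \<in> N"
        have "e \<inter> (set qs - {z, last qs}) = {} \<or> e \<subseteq> set qs - {z, last qs}"
          using q_N e .
        moreover have "e \<inter> {y, y'} = {} \<or> e = {y, y'}"
          using partition_on_unique[OF N(1) e y'(1)] by auto
        ultimately show "e \<inter> (set (qs @ [y', y'']) - {z, last (qs @ [y', y''])}) = {}
          \<or> e \<subseteq> set (qs @ [y', y'']) - {z, last (qs @ [y', y''])}"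
          unfolding eq by blast
      qed
    qed (use q yU y'' new new' in auto)
    then show False
      using max by fastforce
  qed
  moreover have "{last qs, y'} \<in> F"
    using y'(1) N(2) by (auto simp: y_def)
  ultimately show ?thesis
    using q q_M by (intro that) auto
qed

text \<open>\<open>U\<close> is a largest proper nonempty factor-critical set with matchable
  complement. An ear attached to \<open>U\<close> that is closed under the matching of the
  complement preserves all but properness, so it must exhaust \<open>V\<close>.\<close>

lemma last_ear:
  assumes "finite V" and F: "\<forall>f\<in>F. card f = 2"
    and V: "fcrit F V" "card V \<ge> 2"
  obtains U qs where "fcrit F U" "odd_ear F U qs" "U \<union> set qs = V"
proof -
  define P where "P U \<longleftrightarrow> U \<noteq> {} \<and> U \<subset> V \<and> fcrit F U \<and> matchable F (V - U)" for U
  obtain v where v: "v \<in> V"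
    using V(2) by fastforce
  have "matchable F {}"
    by (auto simp: matchable_def partition_on_empty)
  moreover have "V \<noteq> {v}"
    using V(2) by auto
  \<comment> \<open>Deleting \<open>v\<close> from \<open>{v}\<close> leaves the empty set, and
    \<open>V - {v}\<close> is matchable because \<open>V\<close> is factor-critical.\<close>
  ultimately have "P {v}"
    using v V(1) unfolding P_def fcrit_def by auto
  moreover have "card U < Suc (card V)" if "P U" for U
    using that \<open>finite V\<close> unfolding P_def by (simp add: card_mono less_Suc_eq_le psubset_imp_subset)
  ultimately obtain U where U: "P U" and max: "\<And>W. P W \<Longrightarrow> card W \<le> card U"
    using ex_has_greatest_nat[of P "{v}" card "Suc (card V)"] by blast
  note p = U[unfolded P_def]
  have "finite U"
    using p \<open>finite V\<close> finite_subset by blast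
  obtain M where M: "partition_on (V - U) M" "M \<subseteq> F"
    using p unfolding matchable_def by blast
  obtain x where x: "x \<in> V - U"
    using p by blast
  obtain K where K: "partition_on (V - {x}) K" "K \<subseteq> F"
    using V(1) x unfolding fcrit_def matchable_def by blast
  \<comment> \<open>\<open>U\<close> has odd size, since it becomes matchable when one vertex is
    deleted.\<close>
  have "\<not> matchable F U"
  proof
    assume "matchable F U"
    then have "even (card U)"
      using even_card_matchable[OF _ \<open>finite U\<close> F] by simp
    moreover obtain u where u: "u \<in> U" using p by blast
    then have "even (card (U - {u}))"
      using p even_card_matchable[OF _ _ F] \<open>finite U\<close> unfolding fcrit_def by blast
    ultimately show False
      using u \<open>finite U\<close> by (metis card_Suc_Diff1 even_Suc)
  qed
  \<comment> \<open>\<open>K\<close> covers \<open>U\<close>, as \<open>x\<close> lies outside;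
    without an edge leaving \<open>U\<close> it would restrict to a perfect matching of
    \<open>U\<close>. The outer end of such an edge is the start \<open>z\<close> of the
    ear.\<close>
  have "\<exists>e\<in>K. e \<inter> U \<noteq> {} \<and> \<not> e \<subseteq> U"
  proof (rule ccontr)
    assume "\<not> ?thesis"
    moreover have "U \<subseteq> V - {x}"
      using p x by blast
    ultimately have "partition_on U {e \<in> K. e \<subseteq> U}"
      by (intro partition_on_subset[OF K(1)]) auto
    moreover have "{e \<in> K. e \<subseteq> U} \<subseteq> F"
      using K(2) by auto
    ultimately show False
      using \<open>\<not> matchable F U\<close> by (auto simp only: matchable_def)
  qed
  then obtain e u z where e: "e \<in> K" "u \<in> e" "u \<in> U" "z \<in> e" "z \<notin> U"
    by auto
  have "card e = 2"
    using e(1) K(2) F by blast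
  then have "e = {u, z}"
    using e(2-5) by (auto simp: card_2_iff)
  then have uz: "{u, z} \<in> F"
    using e(1) K(2) by blast
  have z: "z \<in> V - U"
    using e K(1) by (auto simp: partition_on_def)
  obtain N where N: "partition_on (V - {z}) N" "N \<subseteq> F"
    using V(1) z unfolding fcrit_def matchable_def by blast
  obtain qs w where qs: "qs \<noteq> []" "even (length qs)" "distinct qs" "path_in F qs"
    "set qs \<subseteq> V - U" "hd qs = z" "\<forall>e\<in>M. e \<inter> set qs = {} \<or> e \<subseteq> set qs"
    "w \<in> U" "{last qs, w} \<in> F"
    using alternating_walk[OF \<open>finite V\<close> F M N z] .
  have ear: "odd_ear F U qs"
    using qs uz e(3) unfolding odd_ear_def by blast
  have "U \<union> set qs = V"
  proof (rule ccontr)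
    assume ne: "U \<union> set qs \<noteq> V"
    have "partition_on (V - (U \<union> set qs)) {e \<in> M. e \<subseteq> V - (U \<union> set qs)}"
    proof (rule partition_on_subset[OF M(1)])
      have "e \<subseteq> V - U" if "e \<in> M" for e
        using M(1) that by (auto simp: partition_on_def)
      then show "\<forall>e\<in>M. e \<inter> (V - (U \<union> set qs)) = {} \<or> e \<subseteq> V - (U \<union> set qs)"
        using qs(7) by blast
    qed auto
    moreover have "{e \<in> M. e \<subseteq> V - (U \<union> set qs)} \<subseteq> F"
      using M(2) by auto
    ultimately have "matchable F (V - (U \<union> set qs))"
      by (auto simp only: matchable_def)
    then have "P (U \<union> set qs)"
      using ne p qs fcrit_ear[OF _ ear] unfolding P_def by blast
    then have "card (U \<union> set qs) \<le> card U"
      by (rule max)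
    moreover have "card U < card (U \<union> set qs)"
      using \<open>finite U\<close> qs(1,5) by (intro psubset_card_mono) (auto simp: neq_Nil_conv)
    ultimately show False by simp
  qed
  then show ?thesis
    using that p ear by blast
qed

section \<open>Choosing the triangle\<close>

text \<open>The induction on the ear's length leaves \<open>U\<close> arbitrary: in the one case
  without a direct matching, \<open>U\<close> grows by a first ear and a shorter last ear
  remains.\<close>

lemma triangle_from_ear:
  assumes F: "\<And>x y. {x, y} \<in> F \<Longrightarrow> x \<noteq> y \<Longrightarrow> \<exists>w\<in>V. w \<noteq> x \<and> w \<noteq> y \<and> {x, y, w} \<in> T"
    and T: "\<And>x y t. t \<in> T \<Longrightarrow> x \<in> t \<Longrightarrow> y \<in> t \<Longrightarrow> x \<noteq> y \<Longrightarrow> {x, y} \<in> F"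
    and "fcrit F U" "odd_ear F U qs" "U \<union> set qs = V"
  shows "\<exists>t\<in>T. matchable F (V - t)"
  using assms(3-5)
proof (induction "length qs" arbitrary: U qs rule: less_induct)
  case less
  note ear = less.prems(2)[unfolded odd_ear_def]
  obtain q1 q2 rs where qs: "qs = q1 # q2 # rs"
    using ear by (cases qs; cases "tl qs") auto
  have "{q1, q2} \<in> F" "q1 \<noteq> q2"
    using ear qs by auto
  then obtain w where w: "w \<in> V" "w \<noteq> q1" "w \<noteq> q2" and t: "{q1, q2, w} \<in> T"
    using F by blast
  obtain y where y: "y \<in> U" "{last qs, y} \<in> F"
    using ear by blast
  show ?case
  proof (cases "w \<in> U")
    case True
    have "matchable F (set rs)"
      using ear qs by (intro matchable_path) (auto simp: successively_Cons)
    moreover have "matchable F (U - {w})"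
      using less.prems(1) True unfolding fcrit_def by blast
    ultimately have "matchable F (set rs \<union> (U - {w}))"
      using ear qs by (intro matchable_Un) auto
    moreover have "set rs \<union> (U - {w}) = V - {q1, q2, w}"
      using ear qs True less.prems(3) by auto
    ultimately show ?thesis
      using t by metis
  next
    case False
    then have "w \<in> set rs"
      using w qs less.prems(3) by auto
    then obtain as bs where rs: "rs = as @ w # bs"
      by (meson split_list)
    show ?thesis
    proof (cases "even (length as)")
      \<comment> \<open>Here \<open>as\<close> is matched within itself, while the odd path
        \<open>bs\<close> borrows the attachment vertex \<open>y\<close>; then
        \<open>U - {y}\<close> is matched.\<close>
      case True
      then have "odd (length bs)"
        using ear qs rs by auto
      then have "bs \<noteq> []"
        by auto
      have "matchable F (set as)"
        using ear qs rs True
        by (intro matchable_path) (auto simp: successively_Cons successively_append_iff)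
      moreover have "matchable F (set (bs @ [y]))"
      proof (rule matchable_path)
        show "distinct (bs @ [y])" "even (length (bs @ [y]))"
          using ear qs rs y(1) \<open>odd (length bs)\<close> by auto
        show "path_in F (bs @ [y])"
          using ear qs rs y(2) \<open>bs \<noteq> []\<close> by (auto simp: successively_Cons successively_append_iff)
      qed
      ultimately have "matchable F (set as \<union> set (bs @ [y]))"
        using ear qs rs y(1) by (intro matchable_Un) auto
      moreover have "matchable F (U - {y})"
        using less.prems(1) y(1) unfolding fcrit_def by blast
      ultimately have "matchable F ((set as \<union> set (bs @ [y])) \<union> (U - {y}))"
        using ear qs rs by (elim matchable_Un) auto
      moreover have "(set as \<union> set (bs @ [y])) \<union> (U - {y}) = V - {q1, q2, w}"
      proof -
        have "q1 \<notin> U" "q2 \<notin> U" "w \<notin> U" "distinct (q1 # q2 # as @ w # bs)"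
          using ear qs rs by auto
        moreover have "V = U \<union> set (q1 # q2 # as @ w # bs)"
          using less.prems(3) qs rs by simp
        ultimately show ?thesis
          using y(1) by auto
      qed
      ultimately show ?thesis
        using t by metis
    next
      case odd: False
      then have "as \<noteq> []"
        by auto
      \<comment> \<open>This chord of the ear lies in the chosen triple. It bypasses
        \<open>q2\<close> and \<open>as\<close>, which then form an ear with ends \<open>q1\<close>
        and \<open>w\<close>.\<close>
      have "{q1, w} \<in> F"
        using T[OF t, of q1 w] w by auto
      then have "odd_ear F U (q1 # w # bs)"
        using ear qs rs odd unfolding odd_ear_def
        by (auto simp: successively_Cons successively_append_iff)
      then have "fcrit F (U \<union> set (q1 # w # bs))"
        using fcrit_ear less.prems(1) by blast
      moreover have "odd_ear F (U \<union> set (q1 # w # bs)) (q2 # as)"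
        using ear qs rs odd \<open>as \<noteq> []\<close> unfolding odd_ear_def
        by (auto simp: successively_Cons successively_append_iff)
      moreover have "(U \<union> set (q1 # w # bs)) \<union> set (q2 # as) = V"
        using less.prems(3) qs rs by auto
      moreover have "length (q2 # as) < length qs"
        using qs rs by simp
      ultimately show ?thesis
        using less.hyps by blast
    qed
  qed
qed

section \<open>Translation to hypergraphs\<close>

theorem lemma2p2:
  fixes V :: "'a set" and E :: "'a set multiset"
  assumes "hypergraph V E"
    and "uniform 3 E"
    and "E \<noteq> {#}"
    and "factor_critical (two_section V E)"
  shows "\<exists>a b c M. triangle E {a, b, c}
    \<and> perfect_matching (delete_verts (two_section V E) {a, b, c}) M
    \<and> partition_on V (insert {a, b, c} M)"
proof -
  define F where "F = edges (two_section V E)"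
  have F2: "\<forall>f\<in>F. card f = 2"
    by (simp add: F_def two_section_def)
  have verts [simp]: "verts (two_section V E) = V"
    by (simp add: two_section_def)
  have finV: "finite V" and sub: "\<And>e. e \<in># E \<Longrightarrow> e \<subseteq> V"
    using assms(1) by (auto simp: hypergraph_def)
  have card3: "\<And>e. e \<in># E \<Longrightarrow> card e = 3"
    using assms(2) by (auto simp: uniform_def)
  have "fcrit F V"
    unfolding fcrit_def
  proof
    fix v assume "v \<in> V"
    then obtain M where "perfect_matching (delete_verts (two_section V E) {v}) M"
      using assms(4) by (auto simp: factor_critical_def)
    then have "M \<subseteq> F" "partition_on (V - {v}) M"
      by (auto simp: perfect_matching_def matching_def delete_verts_def F_def)
    then show "matchable F (V - {v})"
      unfolding matchable_def by blast
  qed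
  \<comment> \<open>A hyperedge forces at least three vertices, which excludes the one-vertex graph:
    it is factor-critical but has no last ear.\<close>
  moreover obtain e where "e \<in># E"
    using assms(3) by blast
  then have "3 \<le> card V"
    using sub card3 finV by (metis card_mono)
  ultimately obtain U qs where "fcrit F U" "odd_ear F U qs" "U \<union> set qs = V"
    using last_ear[OF finV F2] by auto
  moreover have "\<exists>w\<in>V. w \<noteq> x \<and> w \<noteq> y \<and> {x, y, w} \<in> set_mset E"
    if xy: "{x, y} \<in> F" "x \<noteq> y" for x y
  proof -
    obtain e where e: "e \<in># E" "{x, y} \<subseteq> e"
      using xy by (auto simp: F_def two_section_def)
    have "card (e - {x, y}) = 1"
      using card3[OF e(1)] e(2) xy(2) by (simp add: card_Diff_subset)
    then obtain w where "e - {x, y} = {w}"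
      by (auto simp: card_1_singleton_iff)
    then have "e = {x, y, w}" "w \<noteq> x" "w \<noteq> y"
      using e(2) by auto
    then show ?thesis
      using e(1) sub by blast
  qed
  moreover have "{x, y} \<in> F" if "t \<in># E" "x \<in> t" "y \<in> t" "x \<noteq> y" for x y t
    using that by (auto simp: F_def two_section_def)
  ultimately obtain t where t: "t \<in># E" "matchable F (V - t)"
    using triangle_from_ear[of F V "set_mset E" U qs] by blast
  then obtain M where M: "M \<subseteq> F" "partition_on (V - t) M"
    unfolding matchable_def by blast
  obtain a b c where abc: "t = {a, b, c}"
    using card3[OF t(1)] by (auto simp: card_3_iff)
  have "triangle E t"
    using t card3 by (simp add: triangle_def)
  moreover have "perfect_matching (delete_verts (two_section V E) t) M"
    using M unfolding perfect_matching_def matching_def delete_verts_def F_def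
    by (auto simp: partition_on_def)
  moreover have "partition_on V (insert t M)"
  proof -
    have "partition_on t {t}"
      using card3[OF t(1)] by (intro partition_on_space) auto
    then have "partition_on (t \<union> (V - t)) ({t} \<union> M)"
      using M(2) by (intro partition_on_union) auto
    moreover have "t \<union> (V - t) = V"
      using sub[OF t(1)] by blast
    ultimately show ?thesis by simp
  qed
  ultimately show ?thesis
    unfolding abc by blast
qed

end
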